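(* Let $\ell$ be an odd prime power and let $d\geq 1$ be an integer. Let $\mathbb{F}_{\ell^d}^{\times}\rtimes C_2$ be the semidirect product in which the nontrivial element of $C_2$ acts on the multiplicative group $\mathbb{F}_{\ell^d}^{\times}$ by inversion $x\mapsto x^{-1}$. Then \[ \operatorname{sep}_\ell\bigl(\mathbb{F}_{\ell^d}^{\times}\rtimes C_2\bigr)=d+1 . \]
   Context: For an integer $q\geq 2$ write $[q]=\{0,1,\ldots,q-1\}$ for a fixed alphabet of size $q$ (any $q$-element set, such as $\mathbb{F}_q$, may be used instead). For a finite group $G$, a labelling is a map $f:G\to[q]$, and a pattern is an ordered tuple $Y=(y_1,\ldots,y_k)$ of distinct elements of $G$, of size $|Y|=k$. The $Y$-word of $f$ at $g\in G$ is $W_{f,Y}(g)=(f(gy_1),\ldots,f(gy_k))\in[q]^k$. The pair $(f,Y)$ is called separating if $g\mapsto W_{f,Y}(g)$ is injective on $G$. The separating pattern number is \[ \operatorname{sep}_q(G)=\min\{|Y| : \text{there exists } f:G\to[q] \text{ such that } (f,Y) \text{ is separating}\}. \] *)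

theory Defs
  imports
    "HOL-Algebra.Bij"
    "HOL-Algebra.Elementary_Groups"
    "HOL-Algebra.Multiplicative_Group"
    "HOL-Number_Theory.Prime_Powers"
begin

section \<open>Separating patterns\<close>

text \<open>The alphabet \<open>[q] = {0,\<dots>,q-1}\<close> is \<open>{..<q}\<close>; a pattern is a duplicate-free
  list of group elements.\<close>

definition is_labelling :: "nat \<Rightarrow> ('a, 'b) monoid_scheme \<Rightarrow> ('a \<Rightarrow> nat) \<Rightarrow> bool" where
  "is_labelling q G f \<longleftrightarrow> f \<in> carrier G \<rightarrow> {..<q}"

definition is_pattern :: "('a, 'b) monoid_scheme \<Rightarrow> 'a list \<Rightarrow> bool" where
  "is_pattern G Y \<longleftrightarrow> distinct Y \<and> set Y \<subseteq> carrier G"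

definition pattern_word ::
    "('a, 'b) monoid_scheme \<Rightarrow> ('a \<Rightarrow> nat) \<Rightarrow> 'a list \<Rightarrow> 'a \<Rightarrow> nat list" where
  "pattern_word G f Y g = map (\<lambda>y. f (g \<otimes>\<^bsub>G\<^esub> y)) Y"

definition separating :: "('a, 'b) monoid_scheme \<Rightarrow> ('a \<Rightarrow> nat) \<Rightarrow> 'a list \<Rightarrow> bool" where
  "separating G f Y \<longleftrightarrow> inj_on (pattern_word G f Y) (carrier G)"

definition sep_sizes :: "nat \<Rightarrow> ('a, 'b) monoid_scheme \<Rightarrow> nat set" where
  "sep_sizes q G =
     {length Y | Y. is_pattern G Y \<and> (\<exists>f. is_labelling q G f \<and> separating G f Y)}"

text \<open>On \<^typ>\<open>nat\<close>, the infimum of a nonempty set is its minimum; for finite \<open>G\<close> and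
  \<open>q \<ge> 2\<close> the set is nonempty by \<open>sep_sizes_nonempty\<close> below.\<close>

definition sep_number :: "nat \<Rightarrow> ('a, 'b) monoid_scheme \<Rightarrow> nat" where
  "sep_number q G = Inf (sep_sizes q G)"

lemma sep_sizes_nonempty:
  assumes "group G" and "finite (carrier G)" and "q \<ge> 2"
  shows "sep_sizes q G \<noteq> {}"
proof -
  interpret group G by fact
  obtain Y where Y: "set Y = carrier G" "distinct Y"
    using finite_distinct_list[OF assms(2)] by blast
  define f :: "'a \<Rightarrow> nat" where "f = (\<lambda>x. if x = \<one>\<^bsub>G\<^esub> then 1 else 0)"
  have "separating G f Y"
    unfolding separating_def
  proof (rule inj_onI)
    fix g h assume gh: "g \<in> carrier G" "h \<in> carrier G"
      and eq: "pattern_word G f Y g = pattern_word G f Y h"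
    have "f (g \<otimes>\<^bsub>G\<^esub> inv\<^bsub>G\<^esub> g) = f (h \<otimes>\<^bsub>G\<^esub> inv\<^bsub>G\<^esub> g)"
      using eq gh Y inv_closed[of g] unfolding pattern_word_def map_eq_conv by blast
    hence "h \<otimes>\<^bsub>G\<^esub> inv\<^bsub>G\<^esub> g = \<one>\<^bsub>G\<^esub>"
      using gh by (auto simp: f_def split: if_splits)
    thus "g = h" using gh
      by (metis inv_closed inv_equality inv_inv)
  qed
  moreover have "is_labelling q G f"
    using assms(3) by (auto simp: is_labelling_def f_def)
  moreover have "is_pattern G Y"
    using Y by (simp add: is_pattern_def)
  ultimately show ?thesis by (auto simp: sep_sizes_def)
qed

section \<open>Semidirect products\<close>

definition semidirect ::
    "('a, 'c) monoid_scheme \<Rightarrow> ('h, 'd) monoid_scheme \<Rightarrow> ('h \<Rightarrow> 'a \<Rightarrow> 'a) \<Rightarrow> ('a \<times> 'h) monoid" where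
  "semidirect N H \<phi> =
     \<lparr>carrier = carrier N \<times> carrier H,
      monoid.mult = (\<lambda>(n, h) (n', h'). (n \<otimes>\<^bsub>N\<^esub> \<phi> h n', h \<otimes>\<^bsub>H\<^esub> h')),
      one = (\<one>\<^bsub>N\<^esub>, \<one>\<^bsub>H\<^esub>)\<rparr>"

lemma group_semidirect:
  assumes "group N" and "group H" and \<phi>: "\<phi> \<in> hom H (AutoGroup N)"
  shows "group (semidirect N H \<phi>)"
proof -
  interpret N: group N by fact
  interpret H: group H by fact
  interpret A: group "AutoGroup N" by (rule N.AutoGroup)
  interpret \<phi>: group_hom H "AutoGroup N" \<phi>
    using \<phi> by unfold_locales
  have auto: "\<phi> h \<in> auto N" if "h \<in> carrier H" for h
    using \<phi>.hom_closed[OF that] by (simp add: AutoGroup_def)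
  have closed: "\<phi> h x \<in> carrier N" if "h \<in> carrier H" "x \<in> carrier N" for h x
    using auto[OF that(1)] that(2) by (auto simp: auto_def hom_def)
  have mult: "\<phi> h (x \<otimes>\<^bsub>N\<^esub> y) = \<phi> h x \<otimes>\<^bsub>N\<^esub> \<phi> h y"
    if "h \<in> carrier H" "x \<in> carrier N" "y \<in> carrier N" for h x y
    using auto[OF that(1)] that(2,3) by (auto simp: auto_def hom_def)
  have comp: "\<phi> (h \<otimes>\<^bsub>H\<^esub> k) x = \<phi> h (\<phi> k x)"
    if "h \<in> carrier H" "k \<in> carrier H" "x \<in> carrier N" for h k x
    using \<phi>.hom_mult[OF that(1,2)] auto[OF that(1)] auto[OF that(2)] that(3)
    by (simp add: AutoGroup_def BijGroup_def auto_def compose_def)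
  have one: "\<phi> \<one>\<^bsub>H\<^esub> x = x" if "x \<in> carrier N" for x
    using \<phi>.hom_one that by (simp add: AutoGroup_def BijGroup_def)
  show ?thesis
  proof (rule groupI)
    fix p assume "p \<in> carrier (semidirect N H \<phi>)"
    then obtain n h where p: "p = (n, h)" "n \<in> carrier N" "h \<in> carrier H"
      by (auto simp: semidirect_def)
    let ?h = "inv\<^bsub>H\<^esub> h"
    let ?p = "(\<phi> ?h (inv\<^bsub>N\<^esub> n), ?h)"
    have "\<phi> ?h (inv\<^bsub>N\<^esub> n) \<otimes>\<^bsub>N\<^esub> \<phi> ?h n = \<phi> ?h \<one>\<^bsub>N\<^esub>"
      using p mult[of ?h "inv\<^bsub>N\<^esub> n" n] by simp
    moreover have "\<phi> ?h \<one>\<^bsub>N\<^esub> = \<one>\<^bsub>N\<^esub>"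
      using p mult[of ?h "\<one>\<^bsub>N\<^esub>" "\<one>\<^bsub>N\<^esub>"] closed[of ?h "\<one>\<^bsub>N\<^esub>"] by simp
    ultimately show "\<exists>y\<in>carrier (semidirect N H \<phi>). y \<otimes>\<^bsub>semidirect N H \<phi>\<^esub> p = \<one>\<^bsub>semidirect N H \<phi>\<^esub>"
      using p closed[of ?h "inv\<^bsub>N\<^esub> n"] by (intro bexI[of _ ?p]) (auto simp: semidirect_def)
  qed (auto simp: semidirect_def closed mult comp one N.m_assoc H.m_assoc
      simp del: \<phi>.hom_mult \<phi>.hom_one)
qed

text \<open>\<open>C\<^sub>2\<close> is \<^term>\<open>integer_mod_group 2\<close>, with carrier \<open>{0, 1}\<close> and identity \<open>0\<close>.\<close>

definition inversion_action :: "('a, 'b) monoid_scheme \<Rightarrow> int \<Rightarrow> 'a \<Rightarrow> 'a" where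
  "inversion_action N h = (\<lambda>x\<in>carrier N. if h = 0 then x else inv\<^bsub>N\<^esub> x)"

lemma inversion_action_hom:
  assumes "comm_group N"
  shows "inversion_action N \<in> hom (integer_mod_group 2) (AutoGroup N)"
proof -
  interpret comm_group N by fact
  have bij: "bij_betw (inversion_action N h) (carrier N) (carrier N)" for h
    by (rule bij_betwI[of _ _ _ "inversion_action N h"]) (auto simp: inversion_action_def)
  have auto: "inversion_action N h \<in> auto N" for h
    using bij[of h]
    by (auto simp: auto_def Bij_def hom_def inversion_action_def inv_mult)
  show ?thesis
  proof (rule homI)
    fix h k :: int
    assume "h \<in> carrier (integer_mod_group 2)" "k \<in> carrier (integer_mod_group 2)"
    hence "h = 0 \<or> h = 1" "k = 0 \<or> k = 1"
      by (auto simp: carrier_integer_mod_group)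
    thus "inversion_action N (h \<otimes>\<^bsub>integer_mod_group 2\<^esub> k) =
        inversion_action N h \<otimes>\<^bsub>AutoGroup N\<^esub> inversion_action N k"
      using auto[of h] auto[of k]
      by (auto simp: AutoGroup_def BijGroup_def auto_def inversion_action_def compose_def
          fun_eq_iff restrict_def)
  qed (use auto in \<open>simp add: AutoGroup_def\<close>)
qed

text \<open>The theory name is spelled out because \<open>HOL-Algebra.Ring_Divisibility\<close> has a second
  constant \<open>mult_of\<close>.\<close>

definition field_units_semidirect_C2 :: "('a, 'b) ring_scheme \<Rightarrow> ('a \<times> int) monoid" where
  "field_units_semidirect_C2 K =
     semidirect (Multiplicative_Group.mult_of K) (integer_mod_group 2)
       (inversion_action (Multiplicative_Group.mult_of K))"

lemma group_field_units_semidirect_C2: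
  assumes "field K"
  shows "group (field_units_semidirect_C2 K)"
proof -
  interpret field K by fact
  have "comm_group (Multiplicative_Group.mult_of K)"
    by (intro group.group_comm_groupI field_mult_group) (auto simp: m_comm)
  thus ?thesis
    unfolding field_units_semidirect_C2_def
    by (intro group_semidirect inversion_action_hom)
       (simp_all add: comm_group.axioms(2))
qed

end

theory Submission
  imports Defs "HOL-Algebra.Embedded_Algebras"
begin

text \<open>The group has \<open>2 (l\<^sup>d - 1) > l\<^sup>d\<close> elements, so a separating pattern has size at least \<open>d + 1\<close>.

  For the converse let \<open>E\<close> be the subfield of order \<open>l\<close>, let \<open>H\<close> be an \<open>E\<close>-hyperplane of the field and
  \<open>v\<close> a vector outside \<open>H\<close>, and let \<open>lab\<close> label the \<open>l\<close> cosets of \<open>H\<close>. Label \<open>(x, 0)\<close> by \<open>lab x\<close> and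
  \<open>(x, 1)\<close> by \<open>lab (x\<^sup>-\<^sup>1 + v)\<close>. For a pattern of elements \<open>(y, 0)\<close> the words become \<open>lab (x y)\<close> and
  \<open>lab (x\<^sup>-\<^sup>1 y + v)\<close>. At most \<open>d\<close> suitable elements \<open>y\<close> separate each of the two halves, because \<open>x\<close> is
  determined by the cosets of the products \<open>x y\<close>. If \<open>b\<close> is one of these elements, then adding \<open>2 b\<close>
  separates the two halves from each other: the words of the first half satisfy the linear relation
  between \<open>b\<close> and \<open>2 b\<close>, and those of the second half, shifted by the constant \<open>v\<close>, do not.\<close>

section \<open>The Frobenius map\<close>

text \<open>Induction on \<open>n\<close>: the sum is multiplied by \<open>x\<close> and by
  \<open>y\<close>, both products are written in the monomials \<open>?m k\<close> (apart from
  \<open>y [^] Suc n\<close>), and Pascal's rule adds the coefficients.\<close>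

lemma (in cring) binomial_ring:
  assumes [simp]: "x \<in> carrier R" "y \<in> carrier R"
  shows "(x \<oplus> y) [^] (n::nat) = (\<Oplus>k\<in>{..n}. [(n choose k)] \<cdot> (x [^] k \<otimes> y [^] (n - k)))"
proof (induction n)
  case 0
  then show ?case by simp
next
  case (Suc n)
  let ?m = "\<lambda>k. x [^] Suc k \<otimes> y [^] (n - k)"
  let ?B = "\<lambda>n. \<Oplus>k\<in>{..n}. [(n choose k)] \<cdot> (x [^] k \<otimes> y [^] (n - k))"
  have "?B n \<otimes> x = (\<Oplus>k\<in>{..n}. [(n choose k)] \<cdot> (x [^] k \<otimes> y [^] (n - k)) \<otimes> x)"
    by (rule finsum_ldistr) auto
  also have "\<dots> = (\<Oplus>k\<in>{..n}. [(n choose k)] \<cdot> ?m k)"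
    by (rule finsum_cong') (auto simp: add_pow_ldistr add_pow_rdistr m_ac)
  finally have Bx: "?B n \<otimes> x = (\<Oplus>k\<in>{..n}. [(n choose k)] \<cdot> ?m k)" .
  have "?B n \<otimes> y = (\<Oplus>k\<in>{..n}. [(n choose k)] \<cdot> (x [^] k \<otimes> y [^] (n - k)) \<otimes> y)"
    by (rule finsum_ldistr) auto
  also have "\<dots> = (\<Oplus>k\<in>{..n}. [(n choose k)] \<cdot> (x [^] k \<otimes> y [^] (Suc n - k)))"
    by (rule finsum_cong') (auto simp: add_pow_ldistr add_pow_rdistr m_ac Suc_diff_le)
  \<comment> \<open>The extra summand \<open>k = Suc n\<close> has coefficient 0; with it the sum
    has the form from which the term \<open>k = 0\<close> is split off.\<close>
  also have "\<dots> = (\<Oplus>k\<in>{..Suc n}. [(n choose k)] \<cdot> (x [^] k \<otimes> y [^] (Suc n - k)))"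
    by (subst finsum_Suc) (auto simp: binomial_eq_0 simp del: nat_pow_Suc)
  also have "\<dots> = (\<Oplus>k\<in>{..n}. [(n choose Suc k)] \<cdot> ?m k) \<oplus> y [^] Suc n"
    by (subst finsum_Suc2) (auto simp del: nat_pow_Suc)
  finally have By: "?B n \<otimes> y = (\<Oplus>k\<in>{..n}. [(n choose Suc k)] \<cdot> ?m k) \<oplus> y [^] Suc n" .
  have "(x \<oplus> y) [^] Suc n = ?B n \<otimes> x \<oplus> ?B n \<otimes> y"
    by (simp add: Suc.IH r_distr)
  also have "\<dots> = ((\<Oplus>k\<in>{..n}. [(n choose k)] \<cdot> ?m k) \<oplus> (\<Oplus>k\<in>{..n}. [(n choose Suc k)] \<cdot> ?m k))
      \<oplus> y [^] Suc n"
    unfolding Bx By by (intro a_assoc[symmetric]) auto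
  also have "(\<Oplus>k\<in>{..n}. [(n choose k)] \<cdot> ?m k) \<oplus> (\<Oplus>k\<in>{..n}. [(n choose Suc k)] \<cdot> ?m k)
      = (\<Oplus>k\<in>{..n}. [(n choose k)] \<cdot> ?m k \<oplus> [(n choose Suc k)] \<cdot> ?m k)"
    by (rule finsum_addf[symmetric]) auto
  also have "\<dots> = (\<Oplus>k\<in>{..n}. [(Suc n choose Suc k)] \<cdot> ?m k)"
    by (rule finsum_cong') (auto simp: add.nat_pow_mult)
  also have "\<dots> \<oplus> y [^] Suc n = ?B (Suc n)"
    by (subst finsum_Suc2) (auto simp del: nat_pow_Suc)
  finally show ?case .
qed

lemma (in cring) add_pow_eq_zero_of_dvd:
  assumes "[p] \<cdot> \<one> = \<zero>" "p dvd n" "x \<in> carrier R"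
  shows "[(n::nat)] \<cdot> x = \<zero>"
proof -
  obtain k where k: "n = p * k" using assms(2) by blast
  have "[p] \<cdot> x = [p] \<cdot> \<one> \<otimes> x"
    using assms(3) by (simp add: add_pow_ldistr)
  then show ?thesis
    using assms(1,3) by (simp add: k add.nat_pow_pow[symmetric])
qed

text \<open>All binomial coefficients but the first and the last are divisible by \<open>p\<close>,
  so only the two end terms of the expansion survive.\<close>

lemma (in cring) frobenius_add:
  assumes p: "prime (p::nat)" "[p] \<cdot> \<one> = \<zero>" and [simp]: "x \<in> carrier R" "y \<in> carrier R"
  shows "(x \<oplus> y) [^] p = x [^] p \<oplus> y [^] p"
proof -
  \<comment> \<open>With \<open>p = Suc (Suc q)\<close> both end terms can be split off; the inner
    indices are \<open>Suc k\<close> with \<open>k \<le> q\<close>.\<close>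
  define q where "q = p - 2"
  have q: "p = Suc (Suc q)"
    using prime_ge_2_nat[OF p(1)] by (simp add: q_def)
  have zero: "[(p choose Suc k)] \<cdot> (x [^] Suc k \<otimes> y [^] (p - Suc k)) = \<zero>" if "k \<le> q" for k
  proof (rule add_pow_eq_zero_of_dvd[OF p(2)])
    show "p dvd (p choose Suc k)"
      using that p(1) by (intro dvd_choose_prime) (auto simp only: q)
  qed auto
  have "(x \<oplus> y) [^] p = (\<Oplus>k\<in>{..p}. [(p choose k)] \<cdot> (x [^] k \<otimes> y [^] (p - k)))"
    by (rule binomial_ring) auto
  also have "\<dots> = x [^] p \<oplus> (\<Oplus>k\<in>{..Suc q}. [(p choose k)] \<cdot> (x [^] k \<otimes> y [^] (p - k)))"
    unfolding q by (subst finsum_Suc) (auto simp del: nat_pow_Suc binomial_Suc_Suc)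
  also have "(\<Oplus>k\<in>{..Suc q}. [(p choose k)] \<cdot> (x [^] k \<otimes> y [^] (p - k)))
     = (\<Oplus>k\<in>{..q}. [(p choose Suc k)] \<cdot> (x [^] Suc k \<otimes> y [^] (p - Suc k))) \<oplus> y [^] p"
    by (subst finsum_Suc2) (auto simp del: nat_pow_Suc binomial_Suc_Suc)
  also have "(\<Oplus>k\<in>{..q}. [(p choose Suc k)] \<cdot> (x [^] Suc k \<otimes> y [^] (p - Suc k)))
     = (\<Oplus>k\<in>{..q}. \<zero>)"
    by (rule finsum_cong') (use zero in auto)
  finally show ?thesis by simp
qed

lemma (in cring) frobenius_power_add:
  assumes p: "prime (p::nat)" "[p] \<cdot> \<one> = \<zero>" and [simp]: "x \<in> carrier R" "y \<in> carrier R"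
  shows "(x \<oplus> y) [^] (p ^ e) = x [^] (p ^ e) \<oplus> y [^] (p ^ e)"
proof (induction e)
  case (Suc e)
  have "(x \<oplus> y) [^] (p ^ Suc e) = ((x \<oplus> y) [^] (p ^ e)) [^] p"
    by (simp add: nat_pow_pow mult.commute)
  also have "\<dots> = (x [^] (p ^ e)) [^] p \<oplus> (y [^] (p ^ e)) [^] p"
    unfolding Suc by (rule frobenius_add) (use p in auto)
  finally show ?case
    by (simp add: nat_pow_pow mult.commute)
qed (simp add: nat_pow_eone)

text \<open>The additive order kills \<open>p ^ m\<close> times one, which equals the
  \<open>m\<close>-th power of \<open>p\<close> times one; a domain has no nonzero
  nilpotents.\<close>

lemma (in domain) add_pow_prime_one:
  assumes "order R = p ^ m"
  shows "[p] \<cdot> \<one> = \<zero>"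
proof -
  have "[(p ^ m)] \<cdot> \<one> = \<zero>"
    using add.pow_order_eq_1[of \<one>] assms by (simp add: order_def)
  moreover have "[(p ^ m)] \<cdot> \<one> = ([p] \<cdot> \<one>) [^] m"
  proof (induction m)
    case (Suc m)
    have "[(p ^ Suc m)] \<cdot> \<one> = [p] \<cdot> ([(p ^ m)] \<cdot> \<one>)"
      by (simp add: add.nat_pow_pow mult.commute)
    also have "\<dots> = ([(p ^ m)] \<cdot> \<one>) \<otimes> ([p] \<cdot> \<one>)"
      by (simp add: add_pow_rdistr)
    finally show ?case by (simp add: Suc)
  qed simp
  moreover have "x = \<zero>" if "x \<in> carrier R" "x [^] m = \<zero>" for x
    using that by (induction m) (auto simp: integral_iff)
  ultimately show ?thesis by simp
qed

text \<open>The additive group has odd order \<open>2 * k + 1\<close>, so \<open>2 x = 0\<close>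
  would give \<open>x = (2 k + 1) x = 0\<close>.\<close>

lemma (in domain) add_self_neq_zero:
  assumes "odd (order R)" "x \<in> carrier R" "x \<noteq> \<zero>"
  shows "x \<oplus> x \<noteq> \<zero>"
proof
  assume eq: "x \<oplus> x = \<zero>"
  obtain k where k: "order R = 2 * k + 1"
    using assms(1) by (blast elim: oddE)
  have "[(order R)] \<cdot> x = [k] \<cdot> ([(2::nat)] \<cdot> x) \<oplus> x"
    using assms(2) by (simp add: k add.nat_pow_pow)
  also have "[(2::nat)] \<cdot> x = \<zero>"
    using eq assms(2) by (simp add: numeral_2_eq_2)
  finally have "[(order R)] \<cdot> x = x" using assms(2) by simp
  moreover have "[(order R)] \<cdot> x = \<zero>"
    using add.pow_order_eq_1[of x] assms(2) by (simp add: order_def)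
  ultimately show False using assms(3) by simp
qed


section \<open>The subfield of order l\<close>

text \<open>At most \<open>n\<close> roots by degree. At least \<open>n\<close> because the
  multiplicative group is cyclic of order \<open>n * m\<close>: for a generator \<open>a\<close>,
  the powers \<open>a [^] (m * j)\<close> with \<open>j < n\<close> are distinct roots.\<close>

lemma (in field) card_roots_of_unity:
  assumes "finite (carrier R)" "n dvd order R - 1"
  shows "card {x \<in> carrier R. x [^] (n::nat) = \<one>} = n"
proof (rule antisym)
  interpret M: group "Multiplicative_Group.mult_of R" by (rule field_mult_group)
  note [simp] = nat_pow_mult_of
  have order: "order (Multiplicative_Group.mult_of R) = order R - 1"
    using assms(1) by (rule order_mult_of)
  have fin: "finite (carrier (Multiplicative_Group.mult_of R))"
    using assms(1) by simp
  have pos: "order R - 1 > 0"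
    using M.order_gt_0_iff_finite fin by (simp add: order)
  obtain m where m: "order R - 1 = n * m" using assms(2) by blast
  have "n \<noteq> 0" using m pos by auto
  then show "card {x \<in> carrier R. x [^] n = \<one>} \<le> n"
    using num_roots_le_deg[OF assms(1)] by blast
  obtain a where a: "a \<in> carrier (Multiplicative_Group.mult_of R)"
      "carrier (Multiplicative_Group.mult_of R) = {a [^] i | i::nat. i \<in> UNIV}"
    using finite_field_mult_group_has_gen[OF assms(1)] by blast
  have "M.ord a \<noteq> 0"
    using M.ord_ge_1[OF fin a(1)] by linarith
  from M.generate_pow_nat[OF a(1) this]
  have "generate (Multiplicative_Group.mult_of R) {a} = carrier (Multiplicative_Group.mult_of R)"
    unfolding nat_pow_mult_of a(2) .
  then have ord: "M.ord a = order R - 1"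
    using M.generate_pow_card[OF a(1)] order unfolding order_def by simp
  have inj: "inj_on (\<lambda>j. a [^] (m * j)) {..<n}"
  proof (rule inj_onI)
    fix i j assume ij: "i \<in> {..<n}" "j \<in> {..<n}" "a [^] (m * i) = a [^] (m * j)"
    have "m > 0" using m pos by (cases m) auto
    then have "m * i < M.ord a" "m * j < M.ord a"
      unfolding ord m mult.commute[of m] using ij by auto
    then have "m * i = m * j"
      using M.ord_inj[OF a(1)] ij(3) by (auto dest!: inj_onD)
    then show "i = j" using \<open>m > 0\<close> by simp
  qed
  have "(a [^] (m * j)) [^] n = \<one>" for j
  proof -
    have "(a [^] (m * j)) [^] n = (a [^] (order R - 1)) [^] j"
      unfolding m using a(1) by (simp add: nat_pow_pow ac_simps)
    then show ?thesis
      using M.pow_order_eq_1[OF a(1)] order by simp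
  qed
  then have "(\<lambda>j. a [^] (m * j)) ` {..<n} \<subseteq> {x \<in> carrier R. x [^] n = \<one>}"
    using a(1) by auto
  then have "card ((\<lambda>j. a [^] (m * j)) ` {..<n}) \<le> card {x \<in> carrier R. x [^] n = \<one>}"
    using assms(1) by (intro card_mono) auto
  then show "n \<le> card {x \<in> carrier R. x [^] n = \<one>}"
    by (simp add: card_image[OF inj])
qed

text \<open>\<open>E\<close> is the fixed set of \<open>x \<mapsto> x [^] l\<close>, a ring
  endomorphism because it iterates Frobenius. Its nonzero elements are the roots of unity of order
  dividing \<open>l - 1\<close>, which can be counted.\<close>

lemma (in field) ex_subfield_card:
  assumes "primepow l" "order R = l ^ d"
  obtains E where "subfield E R" "card E = l"
proof -
  obtain p e where p: "prime p" "l = p ^ e"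
    using assms(1) by (auto simp: primepow_def)
  have l: "l > 1" using assms(1) by (rule primepow_gt_Suc_0[unfolded One_nat_def[symmetric]])
  \<comment> \<open>An infinite carrier would have \<open>order\<close> 0, while
    \<open>l ^ d\<close> is positive.\<close>
  have fin: "finite (carrier R)"
    using assms(2) l card_ge_0_finite[of "carrier R"] by (simp add: order_def)
  have char: "[p] \<cdot> \<one> = \<zero>"
    using assms(2) by (intro add_pow_prime_one[of _ "e * d"]) (simp add: p(2) power_mult)
  have add: "(x \<oplus> y) [^] l = x [^] l \<oplus> y [^] l" if "x \<in> carrier R" "y \<in> carrier R" for x y
    unfolding p(2) using frobenius_power_add[OF p(1) char that] .
  have zero: "\<zero> [^] l = \<zero>" using l by (simp add: nat_pow_zero)
  have uminus: "(\<ominus> x) [^] l = \<ominus> (x [^] l)" if "x \<in> carrier R" for x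
    using add[of "\<ominus> x" x] that zero by (intro minus_equality[symmetric]) (auto simp: l_neg)
  define E where "E = {x \<in> carrier R. x [^] l = x}"
  have "subfield E R"
  proof (rule subfieldI'[OF subringI])
    fix k assume k: "k \<in> E - {\<zero>}"
    then have [simp]: "k \<in> carrier R" "k [^] l = k" "k \<in> Units R" by (auto simp: E_def field_Units)
    have "k \<otimes> inv k [^] l = (k \<otimes> inv k) [^] l"
      by (subst nat_pow_distrib) auto
    also have "\<dots> = \<one>" by simp
    finally have "inv k = inv k [^] l"
      by (intro comm_inv_char) auto
    then show "inv k \<in> E" by (simp add: E_def)
  qed (auto simp: E_def add uminus nat_pow_distrib)
  moreover have "card E = l"
  proof -
    have "x [^] l = x \<longleftrightarrow> x = \<zero> \<or> x [^] (l - 1) = \<one>" if x: "x \<in> carrier R" for x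
    proof -
      have "x [^] l = x [^] (l - 1) \<otimes> x"
        using nat_pow_Suc[of x "l - 1"] l by simp
      then show ?thesis using x zero by (metis m_rcancel nat_pow_closed l_one one_closed)
    qed
    then have "E = insert \<zero> {x \<in> carrier R. x [^] (l - 1) = \<one>}"
      by (auto simp: E_def)
    moreover have "\<zero> \<notin> {x \<in> carrier R. x [^] (l - 1) = \<one>}"
      using l by (simp add: nat_pow_zero)
    moreover have "l - 1 dvd order R - 1"
    proof -
      \<comment> \<open>Geometric series, applied over the integers to avoid truncated
        subtraction.\<close>
      have "int (l - 1) dvd int (l ^ d - 1)"
        using l by (simp add: of_nat_diff power_diff_1_eq)
      then show ?thesis by (simp only: assms(2) of_nat_dvd_iff)
    qed
    ultimately show ?thesis
      using fin l card_roots_of_unity[OF fin, of "l - 1"] by simp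
  qed
  ultimately show ?thesis by (rule that)
qed


section \<open>Hyperplanes over a subfield\<close>

text \<open>\<open>subalgebra E H R\<close> means an additive subgroup closed under scalars from
  \<open>E\<close>, that is, a subspace; \<open>H\<close> need not be closed under products.\<close>

lemma (in ring) subalgebra_minus_closed:
  assumes "subalgebra E H R" "x \<in> H" "y \<in> H"
  shows "x \<ominus> y \<in> H"
proof -
  interpret subalgebra E H R by fact
  show ?thesis using assms(2,3) m_closed m_inv_closed by (simp add: a_minus_def a_inv_def)
qed

text \<open>\<open>H\<close> is the span of a basis with its first vector \<open>v\<close> removed.
  The last property expresses codimension one: every coset of \<open>H\<close> meets the line
  through \<open>v\<close>.\<close>

lemma (in field) ex_hyperplane:
  assumes E: "subfield E R" and fin: "finite (carrier R)"
  obtains H v where "subalgebra E H R" "v \<in> carrier R" "v \<notin> H"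
    "\<And>x. x \<in> carrier R \<Longrightarrow> \<exists>c\<in>E. x \<ominus> c \<otimes> v \<in> H"
proof -
  obtain Us where Us: "set Us = carrier R" using finite_list[OF fin] by blast
  obtain Vs where Vs: "set Vs \<subseteq> carrier R" "independent E Vs" "Span E Vs = Span E Us"
    using filter_base[OF E, of Us] Us by blast
  have span: "Span E Vs = carrier R"
    using Vs(3) Span_base_incl[OF E, of Us] Span_subgroup_props(1)[OF E, of Us] Us by blast
  have "Span E Vs \<noteq> {\<zero>}"
    using span one_closed one_not_zero by blast
  then have "Vs \<noteq> []" by auto
  then obtain v Ws where VW: "Vs = v # Ws" by (cases Vs) auto
  let ?H = "Span E Ws"
  have Ws: "set Ws \<subseteq> carrier R" and v: "v \<in> carrier R" using Vs(1) VW by auto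
  show ?thesis
  proof (rule that)
    show "subalgebra E ?H R"
      by (intro subalgebra.intro subalgebra_axioms.intro Span_is_add_subgroup[OF E Ws]
          Span_smult_closed[OF E Ws])
    show "v \<in> carrier R" by fact
    show "v \<notin> ?H" using independent_backwards(1) Vs(2) VW by simp
    fix x assume "x \<in> carrier R"
    then obtain c h where ch: "c \<in> E" "h \<in> ?H" "x = c \<otimes> v \<oplus> h"
      using span VW line_extension_mem_iff[of x E v ?H] by auto
    have "c \<in> carrier R" "h \<in> carrier R"
      using ch subfieldE(3)[OF E] Span_subgroup_props(1)[OF E Ws] by blast+
    then have "x \<ominus> c \<otimes> v = h" using v ch(3) by algebra
    then show "\<exists>c\<in>E. x \<ominus> c \<otimes> v \<in> ?H" using ch by blast
  qed
qed

text \<open>The label of \<open>x\<close> is the number, in an enumeration of \<open>E\<close>, of a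
  coefficient \<open>c x\<close> of \<open>v\<close> modulo \<open>H\<close>. Equal labels mean
  equal coefficients, and the multiples of \<open>v\<close> cancel in the difference.\<close>

lemma (in ring) ex_coset_labelling:
  assumes "subalgebra E H R" "finite E" "E \<subseteq> carrier R" "v \<in> carrier R"
    and "\<And>x. x \<in> carrier R \<Longrightarrow> \<exists>c\<in>E. x \<ominus> c \<otimes> v \<in> H"
  obtains lab :: "'a \<Rightarrow> nat" where "lab \<in> carrier R \<rightarrow> {..<card E}"
    "\<And>x y. x \<in> carrier R \<Longrightarrow> y \<in> carrier R \<Longrightarrow> lab x = lab y \<Longrightarrow> x \<ominus> y \<in> H"
proof -
  obtain h where h: "bij_betw h E {0..<card E}"
    using ex_bij_betw_finite_nat[OF assms(2)] by blast
  obtain c where c: "\<And>x. x \<in> carrier R \<Longrightarrow> c x \<in> E \<and> x \<ominus> c x \<otimes> v \<in> H"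
    using assms(5) by metis
  show ?thesis
  proof (rule that)
    show "h \<circ> c \<in> carrier R \<rightarrow> {..<card E}"
      using bij_betwE[OF h] c by auto
    fix x y assume xy: "x \<in> carrier R" "y \<in> carrier R" "(h \<circ> c) x = (h \<circ> c) y"
    then have eq: "c x = c y"
      using bij_betw_imp_inj_on[OF h] c by (auto dest: inj_onD)
    have "(x \<ominus> c x \<otimes> v) \<ominus> (y \<ominus> c y \<otimes> v) \<in> H"
      using subalgebra_minus_closed[OF assms(1)] c xy by blast
    moreover have "c y \<in> carrier R" using c xy assms(3) by blast
    then have "(x \<ominus> c x \<otimes> v) \<ominus> (y \<ominus> c y \<otimes> v) = x \<ominus> y"
      unfolding eq using xy(1,2) assms(4) by algebra
    ultimately show "x \<ominus> y \<in> H" by simp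
  qed
qed

text \<open>Enlarging \<open>S\<close> by \<open>y\<close> with \<open>x \<otimes> y \<notin> H\<close> for some \<open>x\<close> in the annihilator of \<open>S\<close> modulo \<open>H\<close>
  divides the size of this annihilator by at least \<open>card E\<close>.\<close>

lemma (in field) ex_small_separating_set:
  assumes E: "subfield E R" and fin: "finite (carrier R)" and ord: "order R = card E ^ d"
    and H: "subalgebra E H R" and v: "v \<in> carrier R" "v \<notin> H"
  obtains S where "S \<subseteq> carrier R - {\<zero>}" "card S \<le> d"
    "\<And>x. x \<in> carrier R \<Longrightarrow> (\<And>y. y \<in> S \<Longrightarrow> x \<otimes> y \<in> H) \<Longrightarrow> x = \<zero>"
proof -
  interpret H: subalgebra E H R by fact
  have EC: "E \<subseteq> carrier R" using subfieldE(3)[OF E] .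
  have HC: "H \<subseteq> carrier R" using H.subset by simp
  have zero: "\<zero> \<in> H" using H.one_closed by simp
  have add: "a \<oplus> b \<in> H" if "a \<in> H" "b \<in> H" for a b
    using H.m_closed[OF that] by simp
  have "{\<zero>, \<one>} \<subseteq> E"
    using subringE(2,3)[OF subfieldE(1)[OF E]] by blast
  then have "card {\<zero>, \<one>} \<le> card E"
    using finite_subset[OF EC fin] by (rule card_mono[rotated])
  then have cardE: "card E > 1" by simp
  define A where "A S = {x \<in> carrier R. \<forall>y\<in>S. x \<otimes> y \<in> H}" for S
  have finA: "finite (A S)" for S using fin by (simp add: A_def)
  \<comment> \<open>Each element of \<open>S\<close> has to cut the annihilator \<open>A S\<close>
    by a factor \<open>card E\<close>; a maximal \<open>S\<close> with this property will have
    trivial annihilator.\<close>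
  define P where "P S \<longleftrightarrow> S \<subseteq> carrier R - {\<zero>} \<and> card (A S) * card E ^ card S \<le> card E ^ d" for S
  have "P {}" using ord by (simp add: P_def A_def order_def)
  moreover have "finite {S. P S}"
    by (rule finite_subset[of _ "Pow (carrier R)"]) (use fin in \<open>auto simp: P_def\<close>)
  ultimately obtain S where S: "P S" and max: "\<And>T. P T \<Longrightarrow> S \<subseteq> T \<Longrightarrow> S = T"
    using finite_has_maximal[of "{S. P S}"] by auto
  have SC: "S \<subseteq> carrier R - {\<zero>}" using S by (simp add: P_def)
  have finS: "finite S" using SC fin by (blast intro: finite_subset)
  have zA: "\<zero> \<in> A S" using SC zero by (auto simp: A_def)
  show ?thesis
  proof (rule that[OF SC])
    have "1 * card E ^ card S \<le> card (A S) * card E ^ card S"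
      using zA finA[of S] by (intro mult_right_mono) (auto simp: Suc_le_eq card_gt_0_iff)
    also have "\<dots> \<le> card E ^ d" using S by (simp add: P_def)
    finally show "card S \<le> d"
      unfolding mult_1 by (rule power_le_imp_le_exp[OF cardE])
  next
    fix x assume x: "x \<in> carrier R" "\<And>y. y \<in> S \<Longrightarrow> x \<otimes> y \<in> H"
    show "x = \<zero>"
    proof (rule ccontr)
      assume "x \<noteq> \<zero>"
      then have xU: "x \<in> Units R" using x(1) by (simp add: field_Units)
      \<comment> \<open>Chosen so that \<open>x \<otimes> y = v\<close> lies outside
        \<open>H\<close>, whence \<open>y\<close> is new and removes \<open>x\<close> from the
        annihilator.\<close>
      define y where "y = inv x \<otimes> v"
      have y: "y \<in> carrier R" using xU v by (simp add: y_def)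
      have xy: "x \<otimes> y = v" using xU v by (simp add: y_def m_assoc[symmetric] Units_closed)
      have "y \<noteq> \<zero>" using xy v zero x(1) by auto
      have "y \<notin> S" using x(2) xy v(2) by metis
      \<comment> \<open>The line through \<open>x\<close> and the smaller annihilator form a direct
        sum inside \<open>A S\<close>, which gives the factor \<open>card E\<close>.\<close>
      have "inj_on (\<lambda>(c, k). c \<otimes> x \<oplus> k) (E \<times> A (insert y S))"
      proof (rule inj_onI, clarify)
        fix c k c' k'
        assume in_sets: "c \<in> E" "c' \<in> E" "k \<in> A (insert y S)" "k' \<in> A (insert y S)"
          and eq: "c \<otimes> x \<oplus> k = c' \<otimes> x \<oplus> k'"
        have carr: "c \<in> carrier R" "c' \<in> carrier R" "k \<in> carrier R" "k' \<in> carrier R"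
          using in_sets EC by (auto simp: A_def)
        \<comment> \<open>Multiplication by \<open>y\<close> turns the relation into
          \<open>(c - c') v \<in> H\<close>; a nonzero scalar could be inverted in \<open>E\<close>,
          putting \<open>v\<close> into \<open>H\<close>.\<close>
        have "(c \<ominus> c') \<otimes> (x \<otimes> y) = ((c \<otimes> x \<oplus> k) \<ominus> (c' \<otimes> x \<oplus> k')) \<otimes> y \<oplus> (k' \<otimes> y \<ominus> k \<otimes> y)"
          using carr x(1) y by algebra
        also have "\<dots> = k' \<otimes> y \<ominus> k \<otimes> y"
          unfolding eq using carr x(1) y by algebra
        also have "\<dots> \<in> H"
          using in_sets by (intro subalgebra_minus_closed[OF H]) (auto simp: A_def)
        finally have mem: "(c \<ominus> c') \<otimes> v \<in> H" by (simp only: xy)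
        have "c = c'"
        proof (rule ccontr)
          assume "c \<noteq> c'"
          then have "c \<ominus> c' \<noteq> \<zero>" using carr by simp
          moreover have "c \<ominus> c' \<in> E"
            unfolding a_minus_def
            by (intro subringE(7)[OF subfieldE(1)[OF E]] subringE(5)[OF subfieldE(1)[OF E]] in_sets)
          ultimately have nz: "c \<ominus> c' \<in> E - {\<zero>}" by blast
          then have "inv (c \<ominus> c') \<in> E"
            using subfield_m_inv(1)[OF E] by blast
          then have "inv (c \<ominus> c') \<otimes> ((c \<ominus> c') \<otimes> v) \<in> H"
            using mem by (rule H.smult_closed)
          moreover have "c \<ominus> c' \<in> Units R"
            using nz EC by (auto simp: field_Units)
          then have "inv (c \<ominus> c') \<otimes> ((c \<ominus> c') \<otimes> v) = v"
            using v(1) by (simp add: m_assoc[symmetric] Units_closed)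
          ultimately show False using v(2) by simp
        qed
        moreover have "k = k'"
          using eq carr x(1) unfolding \<open>c = c'\<close> by simp
        ultimately show "c = c' \<and> k = k'" by blast
      qed
      moreover have "(\<lambda>(c, k). c \<otimes> x \<oplus> k) ` (E \<times> A (insert y S)) \<subseteq> A S"
      proof (clarify)
        fix c k assume ck: "c \<in> E" "k \<in> A (insert y S)"
        then have carr: "c \<in> carrier R" "k \<in> carrier R" using EC by (auto simp: A_def)
        have "(c \<otimes> x \<oplus> k) \<otimes> z \<in> H" if "z \<in> S" for z
        proof -
          have z: "z \<in> carrier R" using that SC by blast
          have "c \<otimes> (x \<otimes> z) \<oplus> k \<otimes> z \<in> H"
          proof (rule add)
            show "c \<otimes> (x \<otimes> z) \<in> H" using H.smult_closed[OF ck(1) x(2)[OF that]] .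
            show "k \<otimes> z \<in> H" using ck(2) that by (simp add: A_def)
          qed
          then show ?thesis using carr x(1) z by (simp add: l_distr m_assoc)
        qed
        then show "c \<otimes> x \<oplus> k \<in> A S" using carr x(1) by (simp add: A_def)
      qed
      ultimately have "card (E \<times> A (insert y S)) \<le> card (A S)"
        using finA by (rule card_inj_on_le)
      then have "card (A (insert y S)) * card E * card E ^ card S \<le> card (A S) * card E ^ card S"
        by (intro mult_right_mono) (auto simp: card_cartesian_product mult.commute)
      also have "\<dots> \<le> card E ^ d" using S by (simp add: P_def)
      finally have "P (insert y S)"
        using SC y \<open>y \<noteq> \<zero>\<close> \<open>y \<notin> S\<close> finS by (simp add: P_def mult.assoc)
      with max have "S = insert y S" by blast
      with \<open>y \<notin> S\<close> show False by blast
    qed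
  qed
qed


section \<open>Separating patterns\<close>

lemma carrier_field_units_semidirect_C2:
  "carrier (field_units_semidirect_C2 R) = (carrier R - {\<zero>\<^bsub>R\<^esub>}) \<times> {0, 1}"
  by (auto simp: field_units_semidirect_C2_def semidirect_def carrier_integer_mod_group)

text \<open>Right multiplication by \<open>(y, 0)\<close> preserves each half of the group; patterns
  are built from such elements only.\<close>

lemma (in field) mult_field_units_semidirect_C2:
  assumes "y \<in> carrier R - {\<zero>}" "h \<in> {0, 1}"
  shows "(x, h) \<otimes>\<^bsub>field_units_semidirect_C2 R\<^esub> (y, 0) = (x \<otimes> (if h = 0 then y else inv y), h)"
  using assms
  by (auto simp: field_units_semidirect_C2_def semidirect_def inversion_action_def m_inv_mult_of)

text \<open>Separation embeds the group into the set of words of length \<open>k\<close> over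
  \<open>q\<close> letters.\<close>

lemma (in monoid) card_le_of_sep_sizes:
  assumes "k \<in> sep_sizes q G"
  shows "card (carrier G) \<le> q ^ k"
proof -
  obtain Y f where Y: "length Y = k" "is_pattern G Y" "is_labelling q G f" "separating G f Y"
    using assms by (auto simp: sep_sizes_def)
  have "pattern_word G f Y ` carrier G \<subseteq> {xs. set xs \<subseteq> {..<q} \<and> length xs = k}"
    using Y m_closed by (fastforce simp: pattern_word_def is_labelling_def is_pattern_def)
  moreover have "inj_on (pattern_word G f Y) (carrier G)"
    using Y(4) by (simp add: separating_def)
  ultimately have "card (carrier G) \<le> card {xs. set xs \<subseteq> {..<q} \<and> length xs = k}"
    by (intro card_inj_on_le finite_lists_length_eq) auto
  then show ?thesis by (simp add: card_lists_length_eq)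
qed

text \<open>The size is only bounded above, since \<open>S\<close> has at most \<open>d\<close>
  elements and \<open>b \<oplus> b\<close> is not excluded from it; counting later forces
  equality.\<close>

lemma (in field) ex_separating_pattern:
  assumes "primepow l" "odd l" "order R = l ^ d"
  shows "\<exists>k\<in>sep_sizes l (field_units_semidirect_C2 R). k \<le> d + 1"
proof -
  let ?G = "field_units_semidirect_C2 R"
  have l: "l > 1" using primepow_gt_Suc_0[OF assms(1)] by simp
  have fin: "finite (carrier R)"
    using assms(3) l card_ge_0_finite[of "carrier R"] by (simp add: order_def)
  obtain E where E: "subfield E R" "card E = l"
    using ex_subfield_card[OF assms(1,3)] .
  have EC: "E \<subseteq> carrier R" using subfieldE(3)[OF E(1)] .
  obtain H v where H: "subalgebra E H R" and v: "v \<in> carrier R" "v \<notin> H"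
    and Hv: "\<And>x. x \<in> carrier R \<Longrightarrow> \<exists>c\<in>E. x \<ominus> c \<otimes> v \<in> H"
    using ex_hyperplane[OF E(1) fin] by blast
  obtain lab :: "'a \<Rightarrow> nat" where lab: "lab \<in> carrier R \<rightarrow> {..<l}"
    and lab_eq: "\<And>x y. x \<in> carrier R \<Longrightarrow> y \<in> carrier R \<Longrightarrow> lab x = lab y \<Longrightarrow> x \<ominus> y \<in> H"
    using ex_coset_labelling[OF H finite_subset[OF EC fin] EC v(1) Hv] E(2) by metis
  obtain S where S: "S \<subseteq> carrier R - {\<zero>}" "card S \<le> d"
    and S_sep: "\<And>x. x \<in> carrier R \<Longrightarrow> (\<And>y. y \<in> S \<Longrightarrow> x \<otimes> y \<in> H) \<Longrightarrow> x = \<zero>"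
    using ex_small_separating_set[OF E(1) fin _ H v, of d] assms(3) E(2) by metis
  have "S \<noteq> {}" using S_sep[of \<one>] one_not_zero by blast
  then obtain b where b: "b \<in> S" by blast
  then have bC: "b \<in> carrier R" "b \<noteq> \<zero>" using S by auto
  \<comment> \<open>Odd order makes \<open>2 b\<close> a unit, hence usable in the pattern.\<close>
  have bb: "b \<oplus> b \<in> carrier R - {\<zero>}"
    using add_self_neq_zero[of b] bC assms(2,3) by simp
  have finS: "finite S" using S(1) fin by (blast intro: finite_subset)
  obtain ys where ys: "set ys = insert (b \<oplus> b) S" "distinct ys"
    using finite_distinct_list[of "insert (b \<oplus> b) S"] finS by auto
  have ysC: "set ys \<subseteq> carrier R - {\<zero>}" using ys(1) bb S(1) by auto
  define Y where "Y = map (\<lambda>y. (y, 0::int)) ys"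
  \<comment> \<open>Since \<open>(x, 1)\<close> times \<open>(y, 0)\<close> has first component
    \<open>x\<close> times the inverse of \<open>y\<close>, inverting makes the label depend on
    \<open>inv x \<otimes> y\<close>, which is additive in \<open>y\<close>.\<close>
  define f where "f = (\<lambda>(x, h::int). if h = 0 then lab x else lab (inv x \<oplus> v))"
  define w where "w x = map (\<lambda>y. lab (x \<otimes> y)) ys" for x
  define w' where "w' x = map (\<lambda>y. lab (x \<otimes> y \<oplus> v)) ys" for x
  have word0: "pattern_word ?G f Y (x, 0) = w x" for x
    by (auto simp: pattern_word_def Y_def w_def f_def mult_field_units_semidirect_C2[OF subsetD[OF ysC]])
  have word1: "pattern_word ?G f Y (x, 1) = w' (inv x)" if x: "x \<in> carrier R - {\<zero>}" for x
  proof -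
    have "inv (x \<otimes> inv y) = inv x \<otimes> y" if "y \<in> carrier R - {\<zero>}" for y
    proof -
      have U: "x \<in> Units R" "y \<in> Units R" using x that by (auto simp: field_Units)
      have carr: "x \<in> carrier R" "y \<in> carrier R" "inv x \<in> carrier R" "inv y \<in> carrier R"
        using U by auto
      have "(x \<otimes> inv y) \<otimes> (inv x \<otimes> y) = (x \<otimes> inv x) \<otimes> (inv y \<otimes> y)"
        using carr by algebra
      also have "\<dots> = \<one>" using U by simp
      finally show ?thesis using carr by (intro comm_inv_char) auto
    qed
    then show ?thesis
      using subsetD[OF ysC]
      by (auto simp: pattern_word_def Y_def w'_def f_def mult_field_units_semidirect_C2)
  qed
  \<comment> \<open>By distributivity, separating two elements reduces to the trivial annihilator,
    applied to \<open>x \<ominus> z\<close>.\<close>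
  have eq_of_sep: "x = z" if xz: "x \<in> carrier R" "z \<in> carrier R"
    and mem: "\<And>y. y \<in> S \<Longrightarrow> x \<otimes> y \<ominus> z \<otimes> y \<in> H" for x z
  proof -
    have "x \<ominus> z = \<zero>"
    proof (rule S_sep)
      fix y assume y: "y \<in> S"
      then have "y \<in> carrier R" using S by auto
      then have "(x \<ominus> z) \<otimes> y = x \<otimes> y \<ominus> z \<otimes> y" using xz by algebra
      then show "(x \<ominus> z) \<otimes> y \<in> H" using mem[OF y] by simp
    qed (use xz in simp)
    then show "x = z" using xz by simp
  qed
  have w_inj: "x = z" if xz: "x \<in> carrier R" "z \<in> carrier R" "w x = w z" for x z
  proof (rule eq_of_sep[OF xz(1,2)])
    fix y assume "y \<in> S"
    then have "lab (x \<otimes> y) = lab (z \<otimes> y)" "y \<in> carrier R"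
      using xz(3) ys(1) S(1) by (auto simp: w_def)
    then show "x \<otimes> y \<ominus> z \<otimes> y \<in> H" using xz(1,2) by (intro lab_eq) auto
  qed
  have w'_inj: "x = z" if xz: "x \<in> carrier R" "z \<in> carrier R" "w' x = w' z" for x z
  proof (rule eq_of_sep[OF xz(1,2)])
    fix y assume "y \<in> S"
    then have lab: "lab (x \<otimes> y \<oplus> v) = lab (z \<otimes> y \<oplus> v)" and y: "y \<in> carrier R"
      using xz(3) ys(1) S(1) by (auto simp: w'_def)
    have "(x \<otimes> y \<oplus> v) \<ominus> (z \<otimes> y \<oplus> v) \<in> H"
      by (rule lab_eq[OF _ _ lab]) (use xz y v in auto)
    moreover have "(x \<otimes> y \<oplus> v) \<ominus> (z \<otimes> y \<oplus> v) = x \<otimes> y \<ominus> z \<otimes> y"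
      using xz(1,2) y v(1) by algebra
    ultimately show "x \<otimes> y \<ominus> z \<otimes> y \<in> H" by simp
  qed
  \<comment> \<open>Modulo \<open>H\<close>, the difference \<open>(x - z) y\<close> would be \<open>v\<close> both at \<open>y = b\<close> and at \<open>y = 2 b\<close>.\<close>
  have w_w': "w x \<noteq> w' z" if xz: "x \<in> carrier R" "z \<in> carrier R" for x z
  proof
    assume eq: "w x = w' z"
    have diff: "x \<otimes> y \<ominus> (z \<otimes> y \<oplus> v) \<in> H" if y: "y \<in> set ys" for y
    proof -
      have "lab (x \<otimes> y) = lab (z \<otimes> y \<oplus> v)" using eq y by (auto simp: w_def w'_def)
      then show ?thesis using xz y ysC v by (intro lab_eq) auto
    qed
    let ?t = "x \<otimes> b \<ominus> (z \<otimes> b \<oplus> v)" and ?u = "x \<otimes> (b \<oplus> b) \<ominus> (z \<otimes> (b \<oplus> b) \<oplus> v)"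
    have "?t \<in> H" "?u \<in> H"
      using diff ys(1) b by simp_all
    then have "(?u \<ominus> ?t) \<ominus> ?t \<in> H"
      using subalgebra_minus_closed[OF H] by blast
    \<comment> \<open>The terms linear in \<open>b\<close> cancel, and the shifts leave
      \<open>- v + 2 v\<close>.\<close>
    moreover have "(?u \<ominus> ?t) \<ominus> ?t = v"
      using xz bC(1) v(1) by algebra
    ultimately show False using v(2) by simp
  qed
  have "separating ?G f Y"
    unfolding separating_def
  proof (rule inj_onI)
    fix g g' assume g: "g \<in> carrier ?G" "g' \<in> carrier ?G"
      and eq: "pattern_word ?G f Y g = pattern_word ?G f Y g'"
    obtain x h x' h' where xh: "g = (x, h)" "g' = (x', h')" by fastforce
    then have x: "x \<in> carrier R - {\<zero>}" "x' \<in> carrier R - {\<zero>}"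
      and h: "h = 0 \<or> h = 1" "h' = 0 \<or> h' = 1"
      using g by (auto simp: carrier_field_units_semidirect_C2)
    have xU: "x \<in> Units R" "x' \<in> Units R" using x by (auto simp: field_Units)
    then have ix: "inv x \<in> carrier R" "inv x' \<in> carrier R" by auto
    show "g = g'"
      using h
    proof (elim disjE)
      assume "h = 0" "h' = 0"
      then show ?thesis using eq xh word0 w_inj x by auto
    next
      assume h1: "h = 1" "h' = 1"
      then have "inv x = inv x'"
        using eq xh word1 x w'_inj[OF ix] by simp
      then have "x = x'" using xU Units_inv_inv by metis
      then show ?thesis using xh h1 by simp
    next
      assume "h = 0" "h' = 1"
      then show ?thesis using eq xh word0 word1 x w_w'[OF _ ix(2), of x] by simp
    next
      assume "h = 1" "h' = 0"
      then show ?thesis using eq xh word0 word1 x w_w'[OF _ ix(1), of x'] by simp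
    qed
  qed
  moreover have "is_labelling l ?G f"
  proof -
    have "lab (inv x \<oplus> v) < l" if "x \<in> carrier R - {\<zero>}" for x
    proof -
      have "x \<in> Units R" using that by (simp add: field_Units)
      then have "inv x \<oplus> v \<in> carrier R" using v by simp
      then show ?thesis using lab by auto
    qed
    then show ?thesis
      using lab by (auto simp: is_labelling_def f_def carrier_field_units_semidirect_C2 Pi_iff)
  qed
  moreover have "is_pattern ?G Y"
    using ys(2) ysC
    by (auto simp: is_pattern_def Y_def distinct_map inj_on_def carrier_field_units_semidirect_C2)
  moreover have "length Y \<le> d + 1"
    using distinct_card[OF ys(2)] ys(1) S(2) card_insert_le_m1[of "d + 1" S "b \<oplus> b"]
    by (simp add: Y_def)
  ultimately show ?thesis by (auto simp: sep_sizes_def)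
qed

theorem theorem6p2:
  fixes K :: "('a, 'b) ring_scheme" and l d :: nat
  assumes "primepow l" and "odd l" and "d \<ge> 1"
    and "field K" and "order K = l ^ d"
  shows "sep_number l (field_units_semidirect_C2 K) = d + 1"
proof -
  interpret field K by fact
  let ?G = "field_units_semidirect_C2 K"
  obtain k where k: "k \<in> sep_sizes l ?G" "k \<le> d + 1"
    using ex_separating_pattern[OF assms(1,2,5)] by blast
  have l: "l \<ge> 3"
    using primepow_gt_Suc_0[OF assms(1)] assms(2) by (cases "l = 2") auto
  have fin: "finite (carrier K)"
    using assms(5) l card_ge_0_finite[of "carrier K"] by (simp add: order_def)
  have "card (carrier K - {\<zero>\<^bsub>K\<^esub>}) = l ^ d - 1"
    using fin assms(5) by (simp add: order_def)
  then have cardG: "card (carrier ?G) = 2 * (l ^ d - 1)"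
    by (simp add: carrier_field_units_semidirect_C2 card_cartesian_product)
  have lower: "d + 1 \<le> j" if "j \<in> sep_sizes l ?G" for j
  proof (rule ccontr)
    assume "\<not> d + 1 \<le> j"
    then have "l ^ j \<le> l ^ d" using l by (intro power_increasing) auto
    then have "2 * (l ^ d - 1) \<le> l ^ d"
      using monoid.card_le_of_sep_sizes[OF group.is_monoid[OF group_field_units_semidirect_C2[OF assms(4)]] that] cardG by simp
    \<comment> \<open>The previous inequality forces \<open>l ^ d \<le> 2\<close>, whereas
      \<open>l ^ d \<ge> l \<ge> 3\<close>.\<close>
    moreover have "l ^ 1 \<le> l ^ d" using l assms(3) by (intro power_increasing) auto
    ultimately show False using l by simp
  qed
  \<comment> \<open>The attained size \<open>k\<close> is squeezed between both bounds.\<close>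
  then have "d + 1 \<in> sep_sizes l ?G" using k le_antisym by metis
  then show ?thesis
    unfolding sep_number_def using lower by (rule cInf_eq_minimum)
qed

end
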